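(* Let $K$ be a simplicial complex on the vertex set $[m]$. For $i=1,\ldots,m$, the space $\mathbb{R}\mathcal{Z}_K^i$ is obtained from $\mathbb{R}\mathcal{Z}_K^{i-1}$ by attaching cones (one cone on $|\mathrm{Sd}\,K_I|$ for each $I$) by the maps $j_{K_I}\circ\varphi_{K_I}\colon|\mathrm{Sd}\,K_I|\to\mathbb{R}\mathcal{Z}_K^{i-1}$ for all $I\subset[m]$ with $|I|=i$, where $j_{K_I}\colon\mathbb{R}\mathcal{Z}_{K_I}^{i-1}\to\mathbb{R}\mathcal{Z}_K^{i-1}$ is the inclusion.
   Context: Let $[m]=\{1,\ldots,m\}$, $m\ge 1$. $K$ is an abstract simplicial complex on the vertex set $[m]$ (so every $\{i\}$ is a simplex), $|K|$ is its geometric realization, and for $\emptyset\ne I\subset[m]$, $K_I=\{\sigma\in K\mid\sigma\subset I\}$ is the full subcomplex on $I$, a simplicial complex on the vertex set $I$. $\mathrm{Sd}\,K$ is the barycentric subdivision, whose vertices are the non-empty simplices of $K$. $D^1=[-1,1]$ and $S^0=\{-1,+1\}$ with basepoint $-1$. The real moment-angle complex is $\mathbb{R}\mathcal{Z}_K=\bigcup_{\sigma\in K}\{x\in(D^1)^m\mid x_i\in S^0\text{ for }i\notin\sigma\}$, and $\mathbb{R}\mathcal{Z}_K^{k}$ ($0\le k\le m$) is the subspace of points of $\mathbb{R}\mathcal{Z}_K$ at least $m-k$ of whose coordinates equal $-1$. The same definitions apply to $K_I$, giving $\mathbb{R}\mathcal{Z}_{K_I}\subset(D^1)^I$ and $\mathbb{R}\mathcal{Z}_{K_I}^{k}$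 (at least $|I|-k$ coordinates equal to $-1$). $\mathbb{R}\mathcal{Z}_{K_I}$ is identified with the subspace $\{x\in\mathbb{R}\mathcal{Z}_K\mid x_i=-1\text{ for }i\notin I\}$ of $\mathbb{R}\mathcal{Z}_K$. For $\emptyset\ne I\subset[m]$ let $\varphi_{K_I}\colon|\mathrm{Sd}\,K_I|\to\mathbb{R}\mathcal{Z}_{K_I}^{|I|-1}$ be the map that is affine on each simplex of $\mathrm{Sd}\,K_I$ and sends the vertex $\sigma$ to the point whose $i$-th coordinate is $-1$ for $i\in\sigma$ and $+1$ for $i\in I-\sigma$. *)

theory Defs
  imports "HOL-Analysis.Analysis"
begin

section \<open>Abstract simplicial complexes\<close>

text \<open>A complex on a vertex set \<open>V\<close> is the set of its simplices, the empty one included (it belongs to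
  every complex on a non-empty vertex set, by downward closure).  Every element of \<open>V\<close> is a vertex.\<close>

definition abstract_complex :: "'v set \<Rightarrow> 'v set set \<Rightarrow> bool" where
  "abstract_complex V K \<longleftrightarrow>
     (\<forall>\<sigma>\<in>K. finite \<sigma> \<and> \<sigma> \<subseteq> V) \<and> (\<forall>\<sigma>\<in>K. \<forall>\<tau>. \<tau> \<subseteq> \<sigma> \<longrightarrow> \<tau> \<in> K) \<and> (\<forall>v\<in>V. {v} \<in> K)"

definition full_subcomplex :: "'v set set \<Rightarrow> 'v set \<Rightarrow> 'v set set" where
  "full_subcomplex K I = {\<sigma> \<in> K. \<sigma> \<subseteq> I}"

text \<open>The barycentric subdivision: its vertex set and its simplices, the finite chains of non-empty
  simplices.\<close>

definition Sd_vertices :: "'v set set \<Rightarrow> 'v set set" where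
  "Sd_vertices K = K - {{}}"

definition Sd :: "'v set set \<Rightarrow> 'v set set set" where
  "Sd K = {C. finite C \<and> subset.chain (Sd_vertices K) C}"

text \<open>The geometric realization of a complex on a finite vertex set \<open>V\<close>, in barycentric coordinates.
  For finite \<open>V\<close> the topology induced from the product is the usual (weak) one.  As always
  with \<^const>\<open>powertop_real\<close>, points are functions that are \<^const>\<open>undefined\<close> outside \<open>V\<close>.\<close>

definition realization :: "'v set \<Rightarrow> 'v set set \<Rightarrow> ('v \<Rightarrow> real) topology" where
  "realization V K = subtopology (powertop_real V)
     {t. (\<forall>v\<in>V. 0 \<le> t v) \<and> (\<Sum>v\<in>V. t v) = 1 \<and> {v \<in> V. t v \<noteq> 0} \<in> K}"

abbreviation realization_Sd :: "'v set set \<Rightarrow> ('v set \<Rightarrow> real) topology" where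
  "realization_Sd K \<equiv> realization (Sd_vertices K) (Sd K)"

text \<open>The map from the realization of a complex on \<open>V\<close> to the real vector space of functions on \<open>I\<close>
  that is affine on each simplex and sends each vertex \<open>v\<close> to \<open>p v\<close>.\<close>

definition affine_extension :: "'v set \<Rightarrow> 'i set \<Rightarrow> ('v \<Rightarrow> 'i \<Rightarrow> real) \<Rightarrow> ('v \<Rightarrow> real) \<Rightarrow> ('i \<Rightarrow> real)" where
  "affine_extension V I p t = (\<lambda>i\<in>I. \<Sum>v\<in>V. t v * p v i)"


section \<open>Real moment-angle complexes\<close>

definition RZ_points :: "'v set \<Rightarrow> 'v set set \<Rightarrow> ('v \<Rightarrow> real) set" where
  "RZ_points V K = (\<Union>\<sigma>\<in>K. {x \<in> V \<rightarrow>\<^sub>E {-1..1}. \<forall>i\<in>V - \<sigma>. x i \<in> {-1, 1}})"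

definition RZ :: "'v set \<Rightarrow> 'v set set \<Rightarrow> ('v \<Rightarrow> real) topology" where
  "RZ V K = subtopology (powertop_real V) (RZ_points V K)"

text \<open>The filtration, for \<open>k \<le> card V\<close>.\<close>

definition RZ_filtration :: "'v set \<Rightarrow> 'v set set \<Rightarrow> nat \<Rightarrow> ('v \<Rightarrow> real) topology" where
  "RZ_filtration V K k = subtopology (RZ V K) {x. card V - k \<le> card {i \<in> V. x i = -1}}"

text \<open>The inclusion \<open>j\<close> of the real moment-angle complex of the full subcomplex on \<open>I\<close> into that
  of the complex on \<open>V\<close>: missing coordinates are filled in with the basepoint \<open>-1\<close>.\<close>

definition RZ_inclusion :: "'v set \<Rightarrow> 'v set \<Rightarrow> ('v \<Rightarrow> real) \<Rightarrow> ('v \<Rightarrow> real)" where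
  "RZ_inclusion V I x = (\<lambda>i\<in>V. if i \<in> I then x i else -1)"

text \<open>The map \<open>\<phi>\<close> for a complex \<open>L\<close> on the vertex set \<open>I\<close>.\<close>

definition phi_vertex :: "'v set \<Rightarrow> 'v set \<Rightarrow> ('v \<Rightarrow> real)" where
  "phi_vertex I \<sigma> = (\<lambda>i\<in>I. if i \<in> \<sigma> then -1 else 1)"

definition phi :: "'v set \<Rightarrow> 'v set set \<Rightarrow> ('v set \<Rightarrow> real) \<Rightarrow> ('v \<Rightarrow> real)" where
  "phi I L = affine_extension (Sd_vertices L) I (phi_vertex I)"


section \<open>Quotient spaces, cones and attaching\<close>

text \<open>The quotient of \<open>X\<close> by the equivalence relation generated by \<open>r\<close>, whose points are the
  equivalence classes.  It is meant for relations \<open>r\<close> that relate only points of \<open>X\<close>.\<close>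

definition quotient_class :: "'a topology \<Rightarrow> ('a \<Rightarrow> 'a \<Rightarrow> bool) \<Rightarrow> 'a \<Rightarrow> 'a set" where
  "quotient_class X r x = {y \<in> topspace X. equivclp r x y}"

definition quotient_space :: "'a topology \<Rightarrow> ('a \<Rightarrow> 'a \<Rightarrow> bool) \<Rightarrow> 'a set topology" where
  "quotient_space X r = topology (\<lambda>U. U \<subseteq> quotient_class X r ` topspace X \<and>
     openin X {x \<in> topspace X. quotient_class X r x \<in> U})"

lemma openin_quotient_space:
  "openin (quotient_space X r) U \<longleftrightarrow> U \<subseteq> quotient_class X r ` topspace X \<and>
     openin X {x \<in> topspace X. quotient_class X r x \<in> U}"
proof -
  let ?q = "quotient_class X r"
  have 1: "{x \<in> topspace X. ?q x \<in> S \<inter> T} = {x \<in> topspace X. ?q x \<in> S} \<inter> {x \<in> topspace X. ?q x \<in> T}" for S T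
    by auto
  have 2: "{x \<in> topspace X. ?q x \<in> \<Union> \<K>} = (\<Union>S\<in>\<K>. {x \<in> topspace X. ?q x \<in> S})" for \<K>
    by auto
  have "istopology (\<lambda>U. U \<subseteq> ?q ` topspace X \<and> openin X {x \<in> topspace X. ?q x \<in> U})"
    unfolding istopology_def 1 2 by blast
  then show ?thesis
    by (simp add: quotient_space_def)
qed

text \<open>The disjoint union of two spaces of different types (\<^const>\<open>sum_topology\<close> covers families of
  spaces of one type).\<close>

definition disjoint_union_space :: "'a topology \<Rightarrow> 'b topology \<Rightarrow> ('a + 'b) topology" where
  "disjoint_union_space X Y = topology (\<lambda>U. openin X (Inl -` U) \<and> openin Y (Inr -` U))"

lemma openin_disjoint_union_space:
  "openin (disjoint_union_space X Y) U \<longleftrightarrow> openin X (Inl -` U) \<and> openin Y (Inr -` U)"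
proof -
  have "istopology (\<lambda>U. openin X (Inl -` U) \<and> openin Y (Inr -` U))"
    unfolding istopology_def by (auto simp: vimage_Union)
  then show ?thesis
    by (simp add: disjoint_union_space_def)
qed

text \<open>The unreduced cone on a non-empty space \<open>A\<close>: the cylinder with its top \<open>A \<times> {1}\<close> collapsed to the
  apex.  The base point over \<open>a\<close> is the class of \<open>(a, 0)\<close>.\<close>

definition cylinder :: "'a topology \<Rightarrow> ('a \<times> real) topology" where
  "cylinder A = prod_topology A (top_of_set {0..1})"

definition cone_rel :: "'a topology \<Rightarrow> 'a \<times> real \<Rightarrow> 'a \<times> real \<Rightarrow> bool" where
  "cone_rel A p q \<longleftrightarrow> p \<in> topspace A \<times> {1} \<and> q \<in> topspace A \<times> {1}"

definition cone_space :: "'a topology \<Rightarrow> ('a \<times> real) set topology" where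
  "cone_space A = quotient_space (cylinder A) (cone_rel A)"

definition cone_base :: "'a topology \<Rightarrow> 'a \<Rightarrow> ('a \<times> real) set" where
  "cone_base A a = quotient_class (cylinder A) (cone_rel A) (a, 0)"

text \<open>The adjunction space of \<open>X\<close> and the cones on \<open>A i\<close>, for \<open>i \<in> J\<close>, along \<open>f i\<close>: the base point over
  \<open>a\<close> of the \<open>i\<close>-th cone is glued to \<open>f i a\<close>.\<close>

definition space_with_cones ::
  "'b topology \<Rightarrow> ('i \<Rightarrow> 'a topology) \<Rightarrow> 'i set \<Rightarrow> ('b + 'i \<times> ('a \<times> real) set) topology" where
  "space_with_cones X A J = disjoint_union_space X (sum_topology (\<lambda>i. cone_space (A i)) J)"

definition attach_rel ::
  "('i \<Rightarrow> 'a topology) \<Rightarrow> 'i set \<Rightarrow> ('i \<Rightarrow> 'a \<Rightarrow> 'b)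
    \<Rightarrow> 'b + 'i \<times> ('a \<times> real) set \<Rightarrow> 'b + 'i \<times> ('a \<times> real) set \<Rightarrow> bool" where
  "attach_rel A J f p q \<longleftrightarrow>
     (\<exists>i\<in>J. \<exists>a\<in>topspace (A i). p = Inr (i, cone_base (A i) a) \<and> q = Inl (f i a))"

definition attach_cones ::
  "'b topology \<Rightarrow> ('i \<Rightarrow> 'a topology) \<Rightarrow> 'i set \<Rightarrow> ('i \<Rightarrow> 'a \<Rightarrow> 'b)
    \<Rightarrow> ('b + 'i \<times> ('a \<times> real) set) set topology" where
  "attach_cones X A J f = quotient_space (space_with_cones X A J) (attach_rel A J f)"

definition attach_cones_incl ::
  "'b topology \<Rightarrow> ('i \<Rightarrow> 'a topology) \<Rightarrow> 'i set \<Rightarrow> ('i \<Rightarrow> 'a \<Rightarrow> 'b)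
    \<Rightarrow> 'b \<Rightarrow> ('b + 'i \<times> ('a \<times> real) set) set" where
  "attach_cones_incl X A J f x = quotient_class (space_with_cones X A J) (attach_rel A J f) (Inl x)"

text \<open>\<open>Y\<close> is obtained from its subspace \<open>X\<close> by attaching cones on the spaces \<open>A i\<close> by the maps
  \<open>f i : A i \<rightarrow> X\<close>: these maps are continuous and \<open>Y\<close> is homeomorphic to the adjunction space, by a
  homeomorphism that is the identity on \<open>X\<close>.\<close>

definition obtained_by_attaching_cones ::
  "'b topology \<Rightarrow> 'b topology \<Rightarrow> ('i \<Rightarrow> 'a topology) \<Rightarrow> 'i set \<Rightarrow> ('i \<Rightarrow> 'a \<Rightarrow> 'b) \<Rightarrow> bool" where
  "obtained_by_attaching_cones Y X A J f \<longleftrightarrow>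
     topspace X \<subseteq> topspace Y \<and> X = subtopology Y (topspace X) \<and>
     (\<forall>i\<in>J. continuous_map (A i) X (f i)) \<and>
     (\<exists>h. homeomorphic_map (attach_cones X A J f) Y h \<and>
          (\<forall>x\<in>topspace X. h (attach_cones_incl X A J f x) = x))"

end

theory Submission
  imports Defs
begin

text \<open>A point of the \<open>i\<close>-th stage of the filtration that is not in the previous stage has exactly
  \<open>i\<close> coordinates different from \<open>-1\<close>; they form a set \<open>I\<close>, and the point lies in the copy of the
  real moment-angle complex of the full subcomplex \<open>L\<close> on \<open>I\<close>.  Rescale its coordinates to heights
  \<open>w\<^sub>j = (1 - x\<^sub>j) / 2 \<in> [0, 1)\<close>.  Membership in the moment-angle complex now says that the
  support of \<open>w\<close> is a simplex of \<open>L\<close>.  In the same coordinates \<open>\<phi>\<close> sends a point \<open>t\<close> of the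
  barycentric subdivision to the function whose value at \<open>j\<close> is the total weight of the simplices
  containing \<open>j\<close>, and the cone is filled in by the multiples \<open>(1 - s) \<phi>(t)\<close>, with apex \<open>0\<close>,
  that is, the point all of whose coordinates in \<open>I\<close> are \<open>1\<close>.

  The combinatorial heart is that every function \<open>w\<close> with values in \<open>[0, 1]\<close> whose support is a
  simplex of \<open>L\<close> is such a multiple, with unique \<open>s\<close> and, unless \<open>w\<close> is the apex, unique \<open>t\<close>.  This is the layer-cake decomposition: the superlevel sets
  \<open>{j. c \<le> w\<^sub>j}\<close>, for \<open>c > 0\<close>, form a chain of simplices, and the weight of a simplex
  \<open>\<sigma>\<close> must be the length of the set of heights \<open>c\<close> at which the superlevel set is \<open>\<sigma>\<close>
  (\<open>scaled_vertex_mass_surj\<close> and \<open>scaled_vertex_mass_inject\<close>).  Some vertex carries the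
  full weight \<open>1\<close>, namely any vertex of the smallest simplex of the chain
  (\<open>realization_Sd_extremes\<close>), so a point of the cone lies in the previous stage
  precisely when \<open>s = 0\<close>.

  Hence the cones without their bases map bijectively onto the complement of the previous stage.
  The topology comes for free: the disjoint union of the previous stage with the finitely many cones is
  compact and the target is Hausdorff, so the combined map is a quotient map, and its fibres are the
  classes of the gluing relation (\<open>obtained_by_attaching_conesI\<close>).\<close>

section \<open>Chains of sets and layer-cake weights\<close>

text \<open>The length of the set of heights at which the superlevel set of \<open>u\<close> equals \<open>\<sigma>\<close>.  Using
  Lebesgue measure avoids sorting the values of \<open>u\<close>: additivity of the weights is additivity of
  the measure on disjoint sets of heights.\<close>

definition layer_weight :: "'v set \<Rightarrow> ('v \<Rightarrow> real) \<Rightarrow> 'v set \<Rightarrow> real" where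
  "layer_weight I u \<sigma> = measure lborel {c. 0 < c \<and> {j \<in> I. c \<le> u j} = \<sigma>}"

lemma layer_weight_nonneg: "0 \<le> layer_weight I u \<sigma>"
  by (simp add: layer_weight_def)

lemma layer_weight_nonzeroE:
  assumes "layer_weight I u \<sigma> \<noteq> 0"
  obtains c where "0 < c" and "{j \<in> I. c \<le> u j} = \<sigma>"
proof -
  have "{c. 0 < c \<and> {j \<in> I. c \<le> u j} = \<sigma>} \<noteq> {}"
  proof
    assume "{c. 0 < c \<and> {j \<in> I. c \<le> u j} = \<sigma>} = {}"
    then show False
      using assms unfolding layer_weight_def by (simp only: measure_empty)
  qed
  then show ?thesis
    using that by blast
qed

text \<open>Superlevel sets of one function are nested.\<close>

lemma layer_weight_chain:
  assumes "layer_weight I u \<sigma> \<noteq> 0" and "layer_weight I u \<tau> \<noteq> 0"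
  shows "\<sigma> \<subseteq> \<tau> \<or> \<tau> \<subseteq> \<sigma>"
proof -
  obtain c where c: "{j \<in> I. c \<le> u j} = \<sigma>"
    using assms(1) by (rule layer_weight_nonzeroE)
  obtain d where d: "{j \<in> I. d \<le> u j} = \<tau>"
    using assms(2) by (rule layer_weight_nonzeroE)
  show ?thesis
    unfolding c[symmetric] d[symmetric] by (cases "c \<le> d") force+
qed

text \<open>A nonempty \<open>\<sigma>\<close> bounds the heights by the value of \<open>u\<close> at any of its elements; for the empty
  set every large height qualifies and the length is infinite.\<close>

lemma fmeasurable_layer:
  fixes u :: "'v \<Rightarrow> real"
  assumes "finite I" and "\<sigma> \<noteq> {}"
  shows "{c. 0 < c \<and> {j \<in> I. c \<le> u j} = \<sigma>} \<in> fmeasurable lborel"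
proof (cases "\<sigma> \<subseteq> I")
  case False
  then have "{c. 0 < c \<and> {j \<in> I. c \<le> u j} = \<sigma>} = {}"
    by auto
  then show ?thesis
    by (simp only: fmeasurable.empty_sets)
next
  case True
  obtain k where k: "k \<in> \<sigma>"
    using assms(2) by blast
  have eq: "{c. 0 < c \<and> {j \<in> I. c \<le> u j} = \<sigma>}
      = {0<..u k} \<inter> (\<Inter>j\<in>I. if j \<in> \<sigma> then {..u j} else {u j<..})"
  proof (intro equalityI subsetI)
    fix c assume c: "c \<in> {0<..u k} \<inter> (\<Inter>j\<in>I. if j \<in> \<sigma> then {..u j} else {u j<..})"
    then have "c \<in> (if j \<in> \<sigma> then {..u j} else {u j<..})" if "j \<in> I" for j
      using that by blast
    then have "c \<le> u j \<longleftrightarrow> j \<in> \<sigma>" if "j \<in> I" for j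
      using that by (cases "j \<in> \<sigma>") force+
    then show "c \<in> {c. 0 < c \<and> {j \<in> I. c \<le> u j} = \<sigma>}"
      using True c by auto
  qed (use k in auto)
  have "(\<Inter>j\<in>I. if j \<in> \<sigma> then {..u j} else {u j<..}) \<in> sets lborel"
  proof (intro sets.finite_INT)
    show "I \<noteq> {}"
      using True k by auto
  qed (use assms(1) in auto)
  moreover have "{0<..u k} \<in> fmeasurable lborel"
    by (cases "0 \<le> u k") (auto intro!: fmeasurableI)
  ultimately show ?thesis
    unfolding eq by (rule fmeasurable_Int_fmeasurable[rotated])
qed

lemma sum_layer_weight:
  assumes "finite I" and "finite F" and "{} \<notin> F"
  shows "(\<Sum>\<sigma>\<in>F. layer_weight I u \<sigma>) = measure lborel {c. 0 < c \<and> {j \<in> I. c \<le> u j} \<in> F}"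
    and "{c. 0 < c \<and> {j \<in> I. c \<le> u j} \<in> F} \<in> fmeasurable lborel"
proof -
  let ?L = "\<lambda>\<sigma>. {c. 0 < c \<and> {j \<in> I. c \<le> u j} = \<sigma>}"
  have eq: "{c. 0 < c \<and> {j \<in> I. c \<le> u j} \<in> F} = (\<Union>\<sigma>\<in>F. ?L \<sigma>)"
    by auto
  have fm: "?L \<sigma> \<in> fmeasurable lborel" if "\<sigma> \<in> F" for \<sigma>
    using that assms by (intro fmeasurable_layer) auto
  show "(\<Sum>\<sigma>\<in>F. layer_weight I u \<sigma>) = measure lborel {c. 0 < c \<and> {j \<in> I. c \<le> u j} \<in> F}"
    unfolding eq layer_weight_def
    by (rule measure_UNION'[symmetric]) (use fm assms in \<open>auto simp: pairwise_def disjnt_def\<close>)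
  show "{c. 0 < c \<and> {j \<in> I. c \<le> u j} \<in> F} \<in> fmeasurable lborel"
    unfolding eq using fm assms by (intro fmeasurable.finite_UN) auto
qed

text \<open>The superlevel sets containing \<open>j\<close> are those at the heights in \<open>(0, u j]\<close>, an interval of
  length \<open>u j\<close>.\<close>

lemma layer_cake:
  assumes "finite I" and "finite F" and "j \<in> I" and "0 \<le> u j"
    and "\<And>c. 0 < c \<Longrightarrow> c \<le> u j \<Longrightarrow> {k \<in> I. c \<le> u k} \<in> F"
  shows "(\<Sum>\<sigma> | \<sigma> \<in> F \<and> j \<in> \<sigma>. layer_weight I u \<sigma>) = u j"
proof -
  have "(\<Sum>\<sigma> | \<sigma> \<in> F \<and> j \<in> \<sigma>. layer_weight I u \<sigma>)
      = measure lborel {c. 0 < c \<and> {k \<in> I. c \<le> u k} \<in> {\<sigma> \<in> F. j \<in> \<sigma>}}"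
    using assms(1,2) by (intro sum_layer_weight) auto
  also have "{c. 0 < c \<and> {k \<in> I. c \<le> u k} \<in> {\<sigma> \<in> F. j \<in> \<sigma>}} = {0<..u j}"
    using assms(3,5) by auto
  finally show ?thesis
    using assms(4) by simp
qed

lemma sum_layer_weight_le:
  assumes "finite I" and "finite F" and "{} \<notin> F" and "0 \<le> b" and "\<And>j. j \<in> I \<Longrightarrow> u j \<le> b"
  shows "(\<Sum>\<sigma>\<in>F. layer_weight I u \<sigma>) \<le> b"
proof -
  have "{c. 0 < c \<and> {j \<in> I. c \<le> u j} \<in> F} \<subseteq> {0<..b}"
  proof
    fix c assume "c \<in> {c. 0 < c \<and> {j \<in> I. c \<le> u j} \<in> F}"
    moreover from this obtain j where "j \<in> I" "c \<le> u j"
      using assms(3) by (metis (no_types, lifting) empty_Collect_eq mem_Collect_eq)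
    ultimately show "c \<in> {0<..b}"
      using assms(5)[of j] by simp
  qed
  then have "measure lborel {c. 0 < c \<and> {j \<in> I. c \<le> u j} \<in> F} \<le> measure lborel {0<..b}"
    using fmeasurableD[OF sum_layer_weight(2)[OF assms(1-3)]] assms(4)
    by (intro measure_mono_fmeasurable) (auto intro: fmeasurableI)
  then show ?thesis
    using sum_layer_weight(1)[OF assms(1-3), of u] assms(4) by simp
qed

text \<open>Uniqueness of the decomposition along a chain.  Between the total weight of the members strictly
  above \<open>\<sigma>\<close> and that total plus \<open>t \<sigma>\<close>, the superlevel set is \<open>\<sigma>\<close>, so each \<open>t \<sigma>\<close> is at most
  the layer weight.  All heights are bounded by the sum of \<open>t\<close>, so the layer weights have no larger
  sum, and the inequalities must be equalities.\<close>

lemma layer_weight_of_chain: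
  fixes t :: "'v set \<Rightarrow> real"
  assumes "finite I" and "F \<subseteq> Pow I - {{}}"
    and nonneg: "\<And>\<sigma>. \<sigma> \<in> F \<Longrightarrow> 0 \<le> t \<sigma>"
    and chain: "\<And>\<sigma> \<tau>. \<lbrakk>\<sigma> \<in> F; \<tau> \<in> F; t \<sigma> \<noteq> 0; t \<tau> \<noteq> 0\<rbrakk> \<Longrightarrow> \<sigma> \<subseteq> \<tau> \<or> \<tau> \<subseteq> \<sigma>"
    and "\<sigma> \<in> F"
  shows "layer_weight I (\<lambda>j. \<Sum>\<tau> | \<tau> \<in> F \<and> j \<in> \<tau>. t \<tau>) \<sigma> = t \<sigma>"
proof -
  let ?u = "\<lambda>j. \<Sum>\<tau> | \<tau> \<in> F \<and> j \<in> \<tau>. t \<tau>"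
  have F: "finite F"
    using assms(1,2) by (meson finite_Diff finite_Pow_iff finite_subset)
  have le: "t \<sigma> \<le> layer_weight I ?u \<sigma>" if "\<sigma> \<in> F" for \<sigma>
  proof (cases "t \<sigma> = 0")
    case False
    define a where "a = (\<Sum>\<tau> | \<tau> \<in> F \<and> \<sigma> \<subset> \<tau>. t \<tau>)"
    have a: "0 \<le> a"
      unfolding a_def by (intro sum_nonneg) (auto intro: nonneg)
    have inside: "a + t \<sigma> \<le> ?u j" if "j \<in> \<sigma>" for j
    proof -
      have "a + t \<sigma> = sum t (insert \<sigma> {\<tau> \<in> F. \<sigma> \<subset> \<tau>})"
        using F by (simp add: a_def)
      also have "\<dots> \<le> ?u j"
        using F that \<open>\<sigma> \<in> F\<close> by (intro sum_mono2) (auto intro: nonneg)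
      finally show ?thesis .
    qed
    have outside: "?u j \<le> a" if "j \<notin> \<sigma>" for j
    proof -
      have "?u j = (\<Sum>\<tau> | \<tau> \<in> F \<and> j \<in> \<tau> \<and> t \<tau> \<noteq> 0. t \<tau>)"
        using F by (intro sum.mono_neutral_right) auto
      also have "\<dots> \<le> a"
        unfolding a_def
      proof (rule sum_mono2)
        show "{\<tau> \<in> F. j \<in> \<tau> \<and> t \<tau> \<noteq> 0} \<subseteq> {\<tau> \<in> F. \<sigma> \<subset> \<tau>}"
          using chain[OF \<open>\<sigma> \<in> F\<close> _ False] that by blast
      qed (use F nonneg in auto)
      finally show ?thesis .
    qed
    have "{a<..a + t \<sigma>} \<subseteq> {c. 0 < c \<and> {j \<in> I. c \<le> ?u j} = \<sigma>}"
    proof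
      fix c assume c: "c \<in> {a<..a + t \<sigma>}"
      have "c \<le> ?u j \<longleftrightarrow> j \<in> \<sigma>" for j
        using inside[of j] outside[of j] c by (cases "j \<in> \<sigma>") auto
      moreover have "\<sigma> \<subseteq> I"
        using assms(2) \<open>\<sigma> \<in> F\<close> by blast
      ultimately show "c \<in> {c. 0 < c \<and> {j \<in> I. c \<le> ?u j} = \<sigma>}"
        using a c by auto
    qed
    then have "measure lborel {a<..a + t \<sigma>} \<le> layer_weight I ?u \<sigma>"
      unfolding layer_weight_def using assms(1,2) \<open>\<sigma> \<in> F\<close>
      by (intro measure_mono_fmeasurable fmeasurable_layer) auto
    then show ?thesis
      using nonneg[OF \<open>\<sigma> \<in> F\<close>] by simp
  qed (simp add: layer_weight_nonneg)
  have "(\<Sum>\<sigma>\<in>F. layer_weight I ?u \<sigma>) \<le> (\<Sum>\<sigma>\<in>F. t \<sigma>)"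
    using assms(1,2) F
    by (intro sum_layer_weight_le sum_mono2 sum_nonneg) (auto intro: nonneg)
  then have "(\<Sum>\<sigma>\<in>F. layer_weight I ?u \<sigma>) = (\<Sum>\<sigma>\<in>F. t \<sigma>)"
    using sum_mono[OF le] by (rule antisym)
  then show ?thesis
    using sum_mono_inv[where f = t and g = "layer_weight I ?u" and I = F] le \<open>\<sigma> \<in> F\<close> F by simp
qed


section \<open>Quotients, cones and the attaching criterion\<close>

lemma topspace_quotient_space: "topspace (quotient_space X r) = quotient_class X r ` topspace X"
proof -
  have "openin (quotient_space X r) (quotient_class X r ` topspace X)"
    by (auto simp: openin_quotient_space intro: openin_subopen[THEN iffD2])
  then show ?thesis
    by (metis openin_quotient_space openin_subset openin_topspace subset_antisym)
qed

lemma quotient_map_quotient_class: "quotient_map X (quotient_space X r) (quotient_class X r)"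
  by (simp add: quotient_map_def topspace_quotient_space openin_quotient_space)

lemma quotient_class_eq_iff:
  assumes "x \<in> topspace X" and "y \<in> topspace X"
  shows "quotient_class X r x = quotient_class X r y \<longleftrightarrow> equivclp r x y"
proof
  assume "quotient_class X r x = quotient_class X r y"
  moreover have "y \<in> quotient_class X r y"
    using assms by (simp add: quotient_class_def)
  ultimately have "y \<in> quotient_class X r x"
    by simp
  then show "equivclp r x y"
    by (simp add: quotient_class_def)
next
  assume "equivclp r x y"
  then show "quotient_class X r x = quotient_class X r y"
    unfolding quotient_class_def by (blast intro: equivclp_trans equivclp_sym)
qed

lemma equivclp_imp_eq:
  assumes "equivclp r x y" and "\<And>x y. r x y \<Longrightarrow> g x = g y"
  shows "g x = g y"
  using assms(1) by (induction rule: equivclp_induct) (metis assms(2))+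

text \<open>A quotient map is determined, up to homeomorphism of its target, by its fibres.\<close>

lemma homeomorphic_map_from_quotient_space:
  assumes g: "quotient_map X Y g"
    and fibres: "\<And>x y. \<lbrakk>x \<in> topspace X; y \<in> topspace X\<rbrakk> \<Longrightarrow> g x = g y \<longleftrightarrow> equivclp r x y"
  shows "\<exists>h. homeomorphic_map (quotient_space X r) Y h \<and>
    (\<forall>x\<in>topspace X. h (quotient_class X r x) = g x)"
proof -
  obtain h where h: "continuous_map (quotient_space X r) Y h"
      "\<And>x. x \<in> topspace X \<Longrightarrow> h (quotient_class X r x) = g x"
  proof (rule quotient_map_lift_exists)
    show "quotient_map X (quotient_space X r) (quotient_class X r)"
      by (rule quotient_map_quotient_class)
    show "continuous_map X Y g"
      using g by (rule quotient_imp_continuous_map)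
    show "g x = g y" if "x \<in> topspace X" "y \<in> topspace X" "quotient_class X r x = quotient_class X r y" for x y
      using that by (simp add: fibres quotient_class_eq_iff)
  qed blast
  have "quotient_map X Y (h \<circ> quotient_class X r)"
    using g by (rule quotient_map_eq) (simp add: h)
  then have "quotient_map (quotient_space X r) Y h"
    by (simp add: quotient_map_compose_eq[OF quotient_map_quotient_class])
  moreover have "inj_on h (topspace (quotient_space X r))"
    by (auto simp: inj_on_def topspace_quotient_space h fibres quotient_class_eq_iff)
  ultimately show ?thesis
    using h(2) by (auto simp: homeomorphic_map_def)
qed

lemma topspace_disjoint_union_space [simp]:
  "topspace (disjoint_union_space X Y) = topspace X <+> topspace Y"
proof -
  have "Inl -` (topspace X <+> topspace Y) = topspace X" "Inr -` (topspace X <+> topspace Y) = topspace Y"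
    by auto
  then have "openin (disjoint_union_space X Y) (topspace X <+> topspace Y)"
    by (simp add: openin_disjoint_union_space)
  moreover have "U \<subseteq> topspace X <+> topspace Y" if "openin (disjoint_union_space X Y) U" for U
  proof
    fix z assume "z \<in> U"
    then show "z \<in> topspace X <+> topspace Y"
      using that by (cases z) (auto simp: openin_disjoint_union_space dest!: openin_subset)
  qed
  ultimately show ?thesis
    by (meson openin_subset openin_topspace subset_antisym)
qed

lemma compact_space_disjoint_union_space:
  assumes "compact_space X" and "compact_space Y"
  shows "compact_space (disjoint_union_space X Y)"
proof -
  have *: "{x \<in> topspace X. Inl x \<in> U} = Inl -` U" "{y \<in> topspace Y. Inr y \<in> U} = Inr -` U"
    if "openin (disjoint_union_space X Y) U" for U
    using openin_subset[OF that] by auto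
  have "continuous_map X (disjoint_union_space X Y) Inl" "continuous_map Y (disjoint_union_space X Y) Inr"
    by (auto simp: continuous_map_def * openin_disjoint_union_space)
  then have "compactin (disjoint_union_space X Y) (Inl ` topspace X \<union> Inr ` topspace Y)"
    using assms by (intro compactin_Un image_compactin) (auto simp: compact_space_def)
  moreover have "topspace (disjoint_union_space X Y) = Inl ` topspace X \<union> Inr ` topspace Y"
    by auto
  ultimately show ?thesis
    by (simp only: compact_space_def)
qed

lemma compact_space_sum_topology:
  assumes "finite J" and "\<And>i. i \<in> J \<Longrightarrow> compact_space (X i)"
  shows "compact_space (sum_topology X J)"
proof -
  have "compactin (sum_topology X J) (\<Union>i\<in>J. Pair i ` topspace (X i))"
    using assms by (intro compactin_Union)
      (auto intro!: image_compactin continuous_map_component_injection simp: compact_space_def[symmetric])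
  moreover have "(\<Union>i\<in>J. Pair i ` topspace (X i)) = topspace (sum_topology X J)"
    by auto
  ultimately show ?thesis
    by (simp only: compact_space_def)
qed

lemma continuous_map_from_disjoint_union_space:
  assumes "continuous_map X Z f" and "continuous_map Y Z g"
  shows "continuous_map (disjoint_union_space X Y) Z (case_sum f g)"
proof -
  have "Inl -` {z \<in> topspace X <+> topspace Y. case_sum f g z \<in> U} = {x \<in> topspace X. f x \<in> U}"
    "Inr -` {z \<in> topspace X <+> topspace Y. case_sum f g z \<in> U} = {y \<in> topspace Y. g y \<in> U}" for U
    by auto
  then show ?thesis
    using assms by (auto simp: continuous_map_def openin_disjoint_union_space split: sum.splits)
qed

lemma continuous_map_from_sum_topology:
  assumes "\<And>i. i \<in> J \<Longrightarrow> continuous_map (X i) Z (f i)"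
  shows "continuous_map (sum_topology X J) Z (\<lambda>(i, x). f i x)"
proof -
  have "{x. (i, x) \<in> {p \<in> topspace (sum_topology X J). (\<lambda>(i, x). f i x) p \<in> U}}
      = {x \<in> topspace (X i). f i x \<in> U}" if "i \<in> J" for i U
    using that by auto
  moreover have "f i x \<in> topspace Z" if "i \<in> J" "x \<in> topspace (X i)" for i x
    using continuous_map_image_subset_topspace[OF assms] that by blast
  ultimately show ?thesis
    using assms by (auto simp: continuous_map_def openin_sum_topology)
qed

lemma topspace_cylinder: "topspace (cylinder A) = topspace A \<times> {0..1}"
  by (simp add: cylinder_def)

lemma compact_space_cone_space:
  assumes "compact_space A"
  shows "compact_space (cone_space A)"
proof -
  have "compact_space (cylinder A)"
    using assms by (simp add: cylinder_def compact_space_prod_topology compact_space_subtopology)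
  then show ?thesis
    unfolding cone_space_def compact_space_def topspace_quotient_space
    by (rule image_compactin) (rule quotient_imp_continuous_map[OF quotient_map_quotient_class])
qed

text \<open>Attaching cones to a compact subspace of a Hausdorff space can be checked on points.  The maps
  \<open>g i\<close> on the cylinders descend to the cones and, together with the inclusion of \<open>X\<close>, give a
  continuous surjection from a compact space onto a Hausdorff space.  It is closed, hence a quotient map.
  Its fibres are the gluing classes: a point mapped into \<open>X\<close> is equivalent to its image, and over a
  point outside \<open>X\<close> there is only one point of one cone.\<close>

lemma obtained_by_attaching_conesI:
  assumes Y: "Hausdorff_space Y" and X: "compact_space X" "topspace X \<subseteq> topspace Y" "X = subtopology Y (topspace X)"
    and J: "finite J" and A: "\<And>i. i \<in> J \<Longrightarrow> compact_space (A i)"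
    and f: "\<And>i. i \<in> J \<Longrightarrow> continuous_map (A i) X (f i)"
    and g: "\<And>i. i \<in> J \<Longrightarrow> continuous_map (cylinder (A i)) Y (g i)"
    and base: "\<And>i a. \<lbrakk>i \<in> J; a \<in> topspace (A i)\<rbrakk> \<Longrightarrow> g i (a, 0) = f i a"
    and apex: "\<And>i a b. \<lbrakk>i \<in> J; a \<in> topspace (A i); b \<in> topspace (A i)\<rbrakk> \<Longrightarrow> g i (a, 1) = g i (b, 1)"
    and new: "\<And>i a s. \<lbrakk>i \<in> J; a \<in> topspace (A i); 0 < s; s \<le> 1\<rbrakk> \<Longrightarrow> g i (a, s) \<notin> topspace X"
    and inj: "\<And>i a s j b s'. \<lbrakk>i \<in> J; a \<in> topspace (A i); 0 < s; s \<le> 1;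
        j \<in> J; b \<in> topspace (A j); 0 < s'; s' \<le> 1; g i (a, s) = g j (b, s')\<rbrakk>
        \<Longrightarrow> i = j \<and> s = s' \<and> (a = b \<or> s = 1)"
    and surj: "\<And>y. \<lbrakk>y \<in> topspace Y; y \<notin> topspace X\<rbrakk>
        \<Longrightarrow> \<exists>i\<in>J. \<exists>p\<in>topspace (cylinder (A i)). y = g i p"
  shows "obtained_by_attaching_cones Y X A J f"
proof -
  define q where "q = (\<lambda>i. quotient_class (cylinder (A i)) (cone_rel (A i)))"
  have q_eq: "quotient_class (cylinder (A i)) (cone_rel (A i)) = q i" for i
    by (simp add: q_def)
  have top_cone: "topspace (cone_space (A i)) = q i ` (topspace (A i) \<times> {0..1})" for i
    by (simp add: cone_space_def topspace_quotient_space topspace_cylinder q_def)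
  have "\<exists>k. continuous_map (cone_space (A i)) Y k \<and>
      (\<forall>p\<in>topspace (cylinder (A i)). k (q i p) = g i p)" if "i \<in> J" for i
  proof -
    have "g i p = g i p'" if "cone_rel (A i) p p'" for p p'
      using that apex[OF \<open>i \<in> J\<close>] by (auto simp: cone_rel_def)
    then have "g i p = g i p'"
      if "p \<in> topspace (cylinder (A i))" "p' \<in> topspace (cylinder (A i))" "q i p = q i p'" for p p'
      using that unfolding q_def by (metis quotient_class_eq_iff equivclp_imp_eq)
    then show ?thesis
      using quotient_map_lift_exists[OF quotient_map_quotient_class g[OF that], of "cone_rel (A i)"]
      unfolding q_def cone_space_def by metis
  qed
  then obtain k where k: "\<And>i. i \<in> J \<Longrightarrow> continuous_map (cone_space (A i)) Y (k i)"
      and kq: "\<And>i a s. \<lbrakk>i \<in> J; a \<in> topspace (A i); 0 \<le> s; s \<le> 1\<rbrakk> \<Longrightarrow> k i (q i (a, s)) = g i (a, s)"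
    unfolding topspace_cylinder
    by (metis (mono_tags, lifting) atLeastAtMost_iff mem_Sigma_iff)
  define G where "G = case_sum id (\<lambda>(i, c). k i c)"
  let ?Z = "space_with_cones X A J" and ?R = "attach_rel A J f"
  have fX: "f i a \<in> topspace X" if "i \<in> J" "a \<in> topspace (A i)" for i a
    using continuous_map_image_subset_topspace[OF f] that by blast
  have top_Z: "topspace ?Z = topspace X <+> (SIGMA i:J. q i ` (topspace (A i) \<times> {0..1}))"
    by (simp add: space_with_cones_def top_cone comp_def)
  have cases_Z: thesis
    if "z \<in> topspace ?Z"
      and "\<And>x. \<lbrakk>z = Inl x; x \<in> topspace X; G z = x\<rbrakk> \<Longrightarrow> thesis"
      and "\<And>i a s. \<lbrakk>z = Inr (i, q i (a, s)); i \<in> J; a \<in> topspace (A i); 0 \<le> s; s \<le> 1; G z = g i (a, s)\<rbrakk>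
        \<Longrightarrow> thesis" for z thesis
    using that by (auto simp: top_Z G_def kq)
  have cont: "continuous_map ?Z Y G"
    unfolding space_with_cones_def G_def
  proof (intro continuous_map_from_disjoint_union_space continuous_map_from_sum_topology)
    show "continuous_map X Y id"
      by (metis X(3) continuous_map_from_subtopology continuous_map_id)
  qed (rule k)
  have "compact_space ?Z"
    unfolding space_with_cones_def
    by (intro compact_space_disjoint_union_space compact_space_sum_topology compact_space_cone_space X J A)
  then have closed: "closed_map ?Z Y G"
    using cont Y by (intro continuous_imp_closed_map)
  have "topspace Y \<subseteq> G ` topspace ?Z"
  proof
    fix y assume y: "y \<in> topspace Y"
    show "y \<in> G ` topspace ?Z"
    proof (cases "y \<in> topspace X")
      case True
      then show ?thesis
        by (intro image_eqI[where x = "Inl y"]) (auto simp: G_def top_Z)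
    next
      case False
      then obtain i a s where "i \<in> J" "a \<in> topspace (A i)" "0 \<le> s" "s \<le> 1" "y = g i (a, s)"
        using surj[OF y] by (auto simp: topspace_cylinder)
      then show ?thesis
        by (intro image_eqI[where x = "Inr (i, q i (a, s))"]) (auto simp: G_def top_Z kq)
    qed
  qed
  then have quot: "quotient_map ?Z Y G"
    using continuous_map_image_subset_topspace[OF cont]
    by (intro continuous_closed_imp_quotient_map cont closed) blast
  have glue: "?R (Inr (i, q i (a, 0))) (Inl (f i a))" if "i \<in> J" "a \<in> topspace (A i)" for i a
    using that by (auto simp: attach_rel_def cone_base_def q_def)
  \<comment> \<open>Points mapped into \<open>X\<close> have the canonical representative \<open>Inl (G z)\<close>.\<close>
  have old: "equivclp ?R z (Inl (G z))" if "z \<in> topspace ?Z" "G z \<in> topspace X" for z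
    using that(1)
  proof (rule cases_Z)
    fix i a s
    assume z: "z = Inr (i, q i (a, s))" "i \<in> J" "a \<in> topspace (A i)" "0 \<le> s" "s \<le> 1" "G z = g i (a, s)"
    then have "s = 0"
      using new[of i a s] that(2) by fastforce
    then show ?thesis
      using z glue base by auto
  qed simp
  have fibres: "G z = G z' \<longleftrightarrow> equivclp ?R z z'" if z: "z \<in> topspace ?Z" "z' \<in> topspace ?Z" for z z'
  proof
    assume "equivclp ?R z z'"
    then show "G z = G z'"
      by (rule equivclp_imp_eq) (auto simp: attach_rel_def cone_base_def G_def q_eq kq base)
  next
    assume eq: "G z = G z'"
    show "equivclp ?R z z'"
    proof (cases "G z \<in> topspace X")
      case True
      then show ?thesis
        using old z eq by (metis equivclp_trans equivclp_sym)
    next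
      case False
      have new_point: "\<exists>i a s. w = Inr (i, q i (a, s)) \<and> i \<in> J \<and> a \<in> topspace (A i) \<and> 0 < s \<and> s \<le> 1 \<and>
          G w = g i (a, s)" if "w \<in> topspace ?Z" "G w \<notin> topspace X" for w
        using that(1)
      proof (rule cases_Z)
        fix i a s
        assume w: "w = Inr (i, q i (a, s))" "i \<in> J" "a \<in> topspace (A i)" "0 \<le> s" "s \<le> 1" "G w = g i (a, s)"
        then have "s \<noteq> 0"
          using that(2) base fX by auto
        then show ?thesis
          using w by (intro exI[of _ i] exI[of _ a] exI[of _ s]) auto
      qed (use that in simp)
      obtain i a s where 1: "z = Inr (i, q i (a, s))" "i \<in> J" "a \<in> topspace (A i)" "0 < s" "s \<le> 1"
          "G z = g i (a, s)"
        using new_point[OF z(1) False] by blast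
      obtain j b s' where 2: "z' = Inr (j, q j (b, s'))" "j \<in> J" "b \<in> topspace (A j)" "0 < s'" "s' \<le> 1"
          "G z' = g j (b, s')"
        using new_point[OF z(2)] False eq by auto
      have 3: "i = j \<and> s = s' \<and> (a = b \<or> s = 1)"
        using eq 1(6) 2(6) by (intro inj 1 2) simp
      \<comment> \<open>For \<open>s = 1\<close> the points \<open>a\<close> and \<open>b\<close> may differ, but both give the apex.\<close>
      have "q i (a, 1) = q i (b, 1)" if "i = j"
        using that 1(3) 2(3) unfolding q_def
        by (subst quotient_class_eq_iff) (auto simp: topspace_cylinder cone_rel_def)
      then have "z = z'"
        using 1(1) 2(1) 3 by auto
      then show ?thesis
        by simp
    qed
  qed
  obtain h where "homeomorphic_map (quotient_space ?Z ?R) Y h"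
      "\<forall>z\<in>topspace ?Z. h (quotient_class ?Z ?R z) = G z"
    using homeomorphic_map_from_quotient_space[OF quot fibres] by blast
  then have "homeomorphic_map (attach_cones X A J f) Y h \<and>
      (\<forall>x\<in>topspace X. h (attach_cones_incl X A J f x) = x)"
    by (simp add: attach_cones_def attach_cones_incl_def top_Z G_def InlI)
  then show ?thesis
    using X f by (auto simp: obtained_by_attaching_cones_def)
qed

section \<open>Points of the barycentric subdivision\<close>

text \<open>As a function of \<open>j\<close> this is the affine extension that sends the vertex \<open>\<sigma>\<close> of the subdivision
  to the indicator function of \<open>\<sigma>\<close>; it is \<open>(1 - x\<^sub>j) / 2\<close> for the image \<open>x\<close> of \<open>t\<close>
  under \<open>\<phi>\<close>.\<close>

definition vertex_mass :: "'v set set \<Rightarrow> ('v set \<Rightarrow> real) \<Rightarrow> 'v \<Rightarrow> real" where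
  "vertex_mass L t j = (\<Sum>\<sigma> | \<sigma> \<in> Sd_vertices L \<and> j \<in> \<sigma>. t \<sigma>)"

lemma abstract_complexD:
  assumes "abstract_complex V K"
  shows "\<sigma> \<in> K \<Longrightarrow> finite \<sigma>" and "\<sigma> \<in> K \<Longrightarrow> \<sigma> \<subseteq> V"
    and "\<lbrakk>\<sigma> \<in> K; \<tau> \<subseteq> \<sigma>\<rbrakk> \<Longrightarrow> \<tau> \<in> K" and "v \<in> V \<Longrightarrow> {v} \<in> K"
  using assms by (simp_all add: abstract_complex_def)

lemma abstract_complex_full_subcomplex:
  assumes "abstract_complex V K" and "I \<subseteq> V"
  shows "abstract_complex I (full_subcomplex K I)"
  unfolding abstract_complex_def
proof (intro conjI ballI allI impI)
  fix \<sigma> \<tau> assume "\<sigma> \<in> full_subcomplex K I"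
  then have \<sigma>: "\<sigma> \<in> K" "\<sigma> \<subseteq> I"
    by (simp_all add: full_subcomplex_def)
  show "finite \<sigma>" "\<sigma> \<subseteq> I"
    using abstract_complexD(1)[OF assms(1)] \<sigma> by simp_all
  assume "\<tau> \<subseteq> \<sigma>"
  moreover from this have "\<tau> \<in> K"
    using \<sigma>(1) by (rule abstract_complexD(3)[OF assms(1), rotated])
  ultimately show "\<tau> \<in> full_subcomplex K I"
    using \<sigma>(2) by (simp add: full_subcomplex_def)
next
  fix v assume "v \<in> I"
  then show "{v} \<in> full_subcomplex K I"
    using abstract_complexD(4)[OF assms(1)] assms(2) by (auto simp: full_subcomplex_def)
qed

lemma Sd_vertices_subset:
  assumes "abstract_complex I L"
  shows "Sd_vertices L \<subseteq> Pow I - {{}}"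
  using abstract_complexD(2)[OF assms] by (auto simp: Sd_vertices_def)

lemma finite_Sd_vertices:
  assumes "abstract_complex I L" and "finite I"
  shows "finite (Sd_vertices L)"
  using Sd_vertices_subset[OF assms(1)] assms(2) by (meson finite_Diff finite_Pow_iff finite_subset)

lemma in_realization_Sd_iff:
  assumes "finite (Sd_vertices L)"
  shows "t \<in> topspace (realization_Sd L) \<longleftrightarrow>
    t \<in> extensional (Sd_vertices L) \<and> (\<forall>\<sigma>\<in>Sd_vertices L. 0 \<le> t \<sigma>) \<and> (\<Sum>\<sigma>\<in>Sd_vertices L. t \<sigma>) = 1 \<and>
    (\<forall>\<sigma>\<in>{\<sigma> \<in> Sd_vertices L. t \<sigma> \<noteq> 0}. \<forall>\<tau>\<in>{\<sigma> \<in> Sd_vertices L. t \<sigma> \<noteq> 0}. \<sigma> \<subseteq> \<tau> \<or> \<tau> \<subseteq> \<sigma>)"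
proof -
  have "subset.chain (Sd_vertices L) {\<sigma> \<in> Sd_vertices L. t \<sigma> \<noteq> 0} \<longleftrightarrow>
      (\<forall>\<sigma>\<in>{\<sigma> \<in> Sd_vertices L. t \<sigma> \<noteq> 0}. \<forall>\<tau>\<in>{\<sigma> \<in> Sd_vertices L. t \<sigma> \<noteq> 0}. \<sigma> \<subseteq> \<tau> \<or> \<tau> \<subseteq> \<sigma>)"
    unfolding subset_chain_def by (simp only: Collect_restrict simp_thms)
  then show ?thesis
    using assms by (simp add: realization_def Sd_def PiE_def conj_ac)
qed

lemma vertex_mass_bounds:
  assumes "finite (Sd_vertices L)" and "t \<in> topspace (realization_Sd L)"
  shows "0 \<le> vertex_mass L t j" and "vertex_mass L t j \<le> 1"
proof -
  have t: "\<And>\<sigma>. \<sigma> \<in> Sd_vertices L \<Longrightarrow> 0 \<le> t \<sigma>" "(\<Sum>\<sigma>\<in>Sd_vertices L. t \<sigma>) = 1"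
    using assms by (auto simp: in_realization_Sd_iff)
  show "0 \<le> vertex_mass L t j"
    unfolding vertex_mass_def by (intro sum_nonneg) (auto intro: t)
  show "vertex_mass L t j \<le> 1"
    unfolding vertex_mass_def t(2)[symmetric] by (intro sum_mono2) (auto intro: t assms)
qed

text \<open>The weights of \<open>t\<close> sit on a nonempty chain.  The elements of its smallest member lie in every member
  and collect the whole weight; every element with nonzero mass lies in the largest member.\<close>

lemma realization_Sd_extremes:
  assumes "finite (Sd_vertices L)" and "t \<in> topspace (realization_Sd L)"
  obtains \<sigma> \<tau> where "\<sigma> \<in> Sd_vertices L" and "\<tau> \<in> Sd_vertices L"
    and "\<forall>j\<in>\<sigma>. vertex_mass L t j = 1" and "\<forall>j. vertex_mass L t j \<noteq> 0 \<longrightarrow> j \<in> \<tau>"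
proof -
  define C where "C = {\<sigma> \<in> Sd_vertices L. t \<sigma> \<noteq> 0}"
  have t: "\<And>\<sigma>. \<sigma> \<in> Sd_vertices L \<Longrightarrow> 0 \<le> t \<sigma>" "(\<Sum>\<sigma>\<in>Sd_vertices L. t \<sigma>) = 1"
      "\<And>\<sigma> \<tau>. \<lbrakk>\<sigma> \<in> C; \<tau> \<in> C\<rbrakk> \<Longrightarrow> \<sigma> \<subseteq> \<tau> \<or> \<tau> \<subseteq> \<sigma>"
    using assms by (auto simp: in_realization_Sd_iff C_def)
  have C: "finite C"
    using assms(1) by (simp add: C_def)
  have "C \<noteq> {}"
    using t(2) by (metis (mono_tags, lifting) C_def empty_Collect_eq sum.neutral zero_neq_one)
  obtain \<sigma> where \<sigma>: "\<sigma> \<in> C" "\<And>\<rho>. \<rho> \<in> C \<Longrightarrow> \<sigma> \<subseteq> \<rho>"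
    using finite_has_minimal[OF C \<open>C \<noteq> {}\<close>] t(3) by (metis subset_refl)
  obtain \<tau> where \<tau>: "\<tau> \<in> C" "\<And>\<rho>. \<rho> \<in> C \<Longrightarrow> \<rho> \<subseteq> \<tau>"
    using finite_has_maximal[OF C \<open>C \<noteq> {}\<close>] t(3) by (metis subset_refl)
  show thesis
  proof
    show "\<sigma> \<in> Sd_vertices L" "\<tau> \<in> Sd_vertices L"
      using \<sigma> \<tau> by (auto simp: C_def)
    show "\<forall>j\<in>\<sigma>. vertex_mass L t j = 1"
    proof
      fix j assume "j \<in> \<sigma>"
      then have "vertex_mass L t j = (\<Sum>\<sigma>\<in>Sd_vertices L. t \<sigma>)"
        unfolding vertex_mass_def using assms(1) \<sigma>(2)
        by (intro sum.mono_neutral_left) (auto simp: C_def)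
      then show "vertex_mass L t j = 1"
        using t(2) by simp
    qed
    show "\<forall>j. vertex_mass L t j \<noteq> 0 \<longrightarrow> j \<in> \<tau>"
    proof (intro allI impI)
      fix j assume "vertex_mass L t j \<noteq> 0"
      then obtain \<rho> where "\<rho> \<in> C" "j \<in> \<rho>"
        unfolding vertex_mass_def C_def by (auto elim: sum.not_neutral_contains_not_neutral)
      then show "j \<in> \<tau>"
        using \<tau>(2) by blast
    qed
  qed
qed

lemma layer_weight_of_realization_Sd:
  assumes "abstract_complex I L" and "finite I" and "t \<in> topspace (realization_Sd L)"
    and "0 \<le> r" and "\<sigma> \<in> Sd_vertices L"
  shows "layer_weight I (\<lambda>j. r * vertex_mass L t j) \<sigma> = r * t \<sigma>"
proof -
  have fin: "finite (Sd_vertices L)"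
    using assms(1,2) by (rule finite_Sd_vertices)
  have "layer_weight I (\<lambda>j. \<Sum>\<tau> | \<tau> \<in> Sd_vertices L \<and> j \<in> \<tau>. r * t \<tau>) \<sigma> = r * t \<sigma>"
    using assms fin Sd_vertices_subset[OF assms(1)]
    by (intro layer_weight_of_chain) (auto simp: in_realization_Sd_iff)
  then show ?thesis
    by (simp add: vertex_mass_def sum_distrib_left)
qed

text \<open>Both \<open>r t\<close> and \<open>r' t'\<close> are the layer weights of the same function, and as \<open>t\<close> and \<open>t'\<close> have
  total weight \<open>1\<close>, the factors are recovered as sums.\<close>

lemma scaled_vertex_mass_inject:
  assumes L: "abstract_complex I L" "finite I"
    and t: "t \<in> topspace (realization_Sd L)" "t' \<in> topspace (realization_Sd L)"
    and "0 \<le> r" and "0 \<le> r'"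
    and eq: "\<And>j. j \<in> I \<Longrightarrow> r * vertex_mass L t j = r' * vertex_mass L t' j"
  shows "r = r'" and "r \<noteq> 0 \<Longrightarrow> t = t'"
proof -
  have fin: "finite (Sd_vertices L)"
    using L by (rule finite_Sd_vertices)
  have "layer_weight I (\<lambda>j. r * vertex_mass L t j) = layer_weight I (\<lambda>j. r' * vertex_mass L t' j)"
    unfolding layer_weight_def by (simp add: eq cong: conj_cong)
  then have *: "r * t \<sigma> = r' * t' \<sigma>" if "\<sigma> \<in> Sd_vertices L" for \<sigma>
    using layer_weight_of_realization_Sd[OF L] t assms(5,6) that by metis
  have "r * (\<Sum>\<sigma>\<in>Sd_vertices L. t \<sigma>) = r' * (\<Sum>\<sigma>\<in>Sd_vertices L. t' \<sigma>)"
    unfolding sum_distrib_left by (intro sum.cong refl *)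
  then show "r = r'"
    using t fin by (simp add: in_realization_Sd_iff)
  then show "t = t'" if "r \<noteq> 0"
    using t fin that * by (auto simp: in_realization_Sd_iff intro: extensionalityI)
qed

text \<open>The layer weights of \<open>w\<close>, divided by their sum \<open>r\<close>, form a point of the subdivision because
  superlevel sets at positive heights are nonempty subsets of the support of \<open>w\<close>.  If \<open>r = 0\<close> then
  \<open>w = 0\<close> is the apex, and any point will do.\<close>

lemma scaled_vertex_mass_surj:
  assumes L: "abstract_complex I L" "finite I" and "I \<noteq> {}"
    and w: "\<And>j. j \<in> I \<Longrightarrow> 0 \<le> w j" "\<And>j. j \<in> I \<Longrightarrow> w j \<le> 1" and "{j \<in> I. w j \<noteq> 0} \<in> L"
  obtains t r where "t \<in> topspace (realization_Sd L)" and "0 \<le> r" and "r \<le> 1"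
    and "\<forall>j\<in>I. r * vertex_mass L t j = w j"
proof -
  let ?S = "Sd_vertices L"
  have fin: "finite ?S"
    using L by (rule finite_Sd_vertices)
  have S: "{} \<notin> ?S"
    by (simp add: Sd_vertices_def)
  define r where "r = (\<Sum>\<sigma>\<in>?S. layer_weight I w \<sigma>)"
  have r: "0 \<le> r" "r \<le> 1"
    unfolding r_def using L(2) fin S w(2)
    by (auto intro: sum_nonneg sum_layer_weight_le simp: layer_weight_nonneg)
  have cake: "(\<Sum>\<sigma> | \<sigma> \<in> ?S \<and> j \<in> \<sigma>. layer_weight I w \<sigma>) = w j" if "j \<in> I" for j
  proof (rule layer_cake)
    fix c assume "0 < c" "c \<le> w j"
    then have "{k \<in> I. c \<le> w k} \<subseteq> {j \<in> I. w j \<noteq> 0}" "{k \<in> I. c \<le> w k} \<noteq> {}"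
      using that by auto
    then show "{k \<in> I. c \<le> w k} \<in> ?S"
      using abstract_complexD(3)[OF L(1) assms(6)] by (simp add: Sd_vertices_def)
  qed (use L fin w that in auto)
  show thesis
  proof (cases "r = 0")
    case True
    then have "layer_weight I w \<sigma> = 0" if "\<sigma> \<in> ?S" for \<sigma>
      using that fin by (auto simp: r_def sum_nonneg_eq_0_iff layer_weight_nonneg)
    then have w0: "w j = 0" if "j \<in> I" for j
      using cake[OF that] by (simp flip: cake[OF that])
    obtain k where "k \<in> I"
      using \<open>I \<noteq> {}\<close> by blast
    then have k: "{k} \<in> ?S"
      using abstract_complexD(4)[OF L(1)] by (simp add: Sd_vertices_def)
    have "(\<lambda>\<sigma>\<in>?S. if \<sigma> = {k} then 1 else 0) \<in> topspace (realization_Sd L)"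
      using fin k by (auto simp: in_realization_Sd_iff)
    then show thesis
      using that[of _ 0] w0 by simp
  next
    case False
    define t where "t = (\<lambda>\<sigma>\<in>?S. layer_weight I w \<sigma> / r)"
    have "t \<in> topspace (realization_Sd L)"
      using fin False r(1)
      by (auto simp: in_realization_Sd_iff t_def r_def[symmetric] layer_weight_nonneg
          simp flip: sum_divide_distrib dest: layer_weight_chain)
    moreover have "r * vertex_mass L t j = w j" if "j \<in> I" for j
    proof -
      have "r * vertex_mass L t j = (\<Sum>\<sigma> | \<sigma> \<in> ?S \<and> j \<in> \<sigma>. layer_weight I w \<sigma>)"
        unfolding vertex_mass_def sum_distrib_left using False by (intro sum.cong) (auto simp: t_def)
      then show ?thesis
        using cake[OF that] by simp
    qed
    ultimately show thesis
      using that r by blast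
  qed
qed


section \<open>Compactness\<close>

text \<open>The condition that the support is a simplex is closed because it is equivalent to vanishing
  outside some simplex: this exhibits the realization as a closed subset of a finite union of cubes.\<close>

lemma compact_space_realization:
  assumes "finite V" and down: "\<And>\<sigma> \<tau>. \<lbrakk>\<sigma> \<in> K; \<tau> \<subseteq> \<sigma>\<rbrakk> \<Longrightarrow> \<tau> \<in> K"
  shows "compact_space (realization V K)"
proof -
  let ?T = "{t. (\<forall>v\<in>V. 0 \<le> t v) \<and> (\<Sum>v\<in>V. t v) = 1 \<and> {v \<in> V. t v \<noteq> 0} \<in> K}"
  let ?P = "\<Union>\<sigma>\<in>K \<inter> Pow V. \<Pi>\<^sub>E v\<in>V. if v \<in> \<sigma> then {0..1} else {0::real}"
  let ?H = "{t \<in> topspace (powertop_real V). (\<Sum>v\<in>V. t v) \<in> {1}}"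
  have "compactin (powertop_real V) ?P"
    using assms(1) by (intro compactin_Union) (auto simp: compactin_PiE)
  moreover have "closedin (powertop_real V) ?H"
    using assms(1) by (intro closedin_continuous_map_preimage[where Y = euclidean] continuous_intros) auto
  ultimately have "compactin (powertop_real V) (?P \<inter> ?H)"
    by (rule compact_Int_closedin)
  also have "?P \<inter> ?H = topspace (powertop_real V) \<inter> ?T"
  proof (intro equalityI subsetI)
    fix t assume t: "t \<in> ?P \<inter> ?H"
    then obtain \<sigma> where \<sigma>: "\<sigma> \<in> K" "t \<in> (\<Pi>\<^sub>E v\<in>V. if v \<in> \<sigma> then {0..1} else {0})"
      by blast
    have *: "t v \<in> (if v \<in> \<sigma> then {0..1} else {0})" if "v \<in> V" for v
      using \<sigma>(2) that by (rule PiE_mem)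
    have "0 \<le> t v" if "v \<in> V" for v
      using *[OF that] by (auto split: if_splits)
    moreover have "v \<in> \<sigma>" if "v \<in> V" "t v \<noteq> 0" for v
      using *[OF that(1)] that(2) by (auto split: if_splits)
    then have "{v \<in> V. t v \<noteq> 0} \<subseteq> \<sigma>"
      by blast
    then have "{v \<in> V. t v \<noteq> 0} \<in> K"
      by (rule down[OF \<sigma>(1)])
    ultimately show "t \<in> topspace (powertop_real V) \<inter> ?T"
      using t by auto
  next
    fix t assume t: "t \<in> topspace (powertop_real V) \<inter> ?T"
    then have "t v \<le> 1" if "v \<in> V" for v
      using member_le_sum[of v V t] assms(1) that by auto
    then have "t \<in> (\<Pi>\<^sub>E v\<in>V. if v \<in> {v \<in> V. t v \<noteq> 0} then {0..1} else {0})"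
      using t by (auto simp: PiE_iff)
    then show "t \<in> ?P \<inter> ?H"
      using t by blast
  qed
  finally show ?thesis
    unfolding realization_def subtopology_restrict[symmetric, of "powertop_real V" ?T]
    by (rule compact_space_subtopology)
qed

lemma compact_space_realization_Sd:
  assumes "abstract_complex I L" and "finite I"
  shows "compact_space (realization_Sd L)"
proof (rule compact_space_realization)
  show "finite (Sd_vertices L)"
    using assms by (rule finite_Sd_vertices)
  show "\<tau> \<in> Sd L" if "\<sigma> \<in> Sd L" "\<tau> \<subseteq> \<sigma>" for \<sigma> \<tau>
    using that by (simp add: Sd_def subset_chain_def finite_subset[of \<tau> \<sigma>]) (meson subsetD subset_trans)
qed

lemma RZ_points_subset: "RZ_points V K \<subseteq> V \<rightarrow>\<^sub>E {-1..1}"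
  unfolding RZ_points_def by fast

lemma topspace_RZ_filtration:
  "topspace (RZ_filtration V K k) = {x \<in> RZ_points V K. card V - k \<le> card {i \<in> V. x i = -1}}"
proof -
  have "V \<rightarrow>\<^sub>E {-1..1} \<subseteq> topspace (powertop_real V)"
    by auto
  then have "RZ_points V K \<subseteq> topspace (powertop_real V)"
    using RZ_points_subset by (rule order_trans[rotated])
  moreover have "topspace (RZ_filtration V K k)
      = topspace (powertop_real V) \<inter> (RZ_points V K \<inter> {x. card V - k \<le> card {i \<in> V. x i = -1}})"
    by (simp only: RZ_filtration_def RZ_def topspace_subtopology Int_assoc)
  ultimately show ?thesis
    by fast
qed

lemma RZ_filtration_eq_subtopology:
  "RZ_filtration V K k = subtopology (powertop_real V) (topspace (RZ_filtration V K k))"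
  unfolding RZ_filtration_def RZ_def subtopology_subtopology topspace_subtopology
  by (rule subtopology_restrict[symmetric])

lemma Hausdorff_space_RZ_filtration: "Hausdorff_space (RZ_filtration V K k)"
  unfolding RZ_filtration_def RZ_def
  by (intro Hausdorff_space_subtopology) (metis Hausdorff_space_euclidean Hausdorff_space_product_topology)

text \<open>Each stage is a finite union of products of intervals and finite sets, indexed by a simplex and
  a set \<open>N\<close> of coordinates that are required to be \<open>-1\<close>.\<close>

lemma compact_space_RZ_filtration:
  assumes "finite V" and "\<And>\<sigma>. \<sigma> \<in> K \<Longrightarrow> \<sigma> \<subseteq> V"
  shows "compact_space (RZ_filtration V K k)"
proof -
  define cell where "cell = (\<lambda>(\<sigma>, N). \<Pi>\<^sub>E i\<in>V. if i \<in> N then {-1} else if i \<in> \<sigma> then {-1..1} else {-1, 1::real})"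
  let ?F = "K \<times> {N. N \<subseteq> V \<and> card V - k \<le> card N}"
  have "finite K"
    using assms by (meson PowI finite_Pow_iff finite_subset subsetI)
  then have "finite ?F"
    using assms(1) by auto
  then have "compactin (powertop_real V) (\<Union>p\<in>?F. cell p)"
    by (intro compactin_Union) (auto simp: cell_def compactin_PiE finite_imp_compact)
  also have "(\<Union>p\<in>?F. cell p) = topspace (RZ_filtration V K k)"
  proof (intro equalityI subsetI)
    fix x assume "x \<in> (\<Union>p\<in>?F. cell p)"
    then obtain \<sigma> N where \<sigma>: "\<sigma> \<in> K" and N: "N \<subseteq> V" "card V - k \<le> card N" and x: "x \<in> cell (\<sigma>, N)"
      by blast
    have *: "x i \<in> (if i \<in> N then {-1} else if i \<in> \<sigma> then {-1..1} else {-1, 1})" if "i \<in> V" for i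
      using x that unfolding cell_def prod.case by (rule PiE_mem)
    have "x \<in> V \<rightarrow>\<^sub>E {-1..1}"
    proof (rule PiE_I)
      show "x i \<in> {-1..1}" if "i \<in> V" for i
        using *[OF that] by (auto split: if_splits)
      show "x i = undefined" if "i \<notin> V" for i
        using x that unfolding cell_def prod.case by (rule PiE_arb)
    qed
    moreover have "x i \<in> {-1, 1}" if "i \<in> V - \<sigma>" for i
      using *[of i] that by (auto split: if_splits)
    moreover have "N \<subseteq> {i \<in> V. x i = -1}"
      using N(1) * by fastforce
    then have "card N \<le> card {i \<in> V. x i = -1}"
      using assms(1) by (intro card_mono) auto
    ultimately show "x \<in> topspace (RZ_filtration V K k)"
      using \<sigma> N(2) by (auto simp: topspace_RZ_filtration RZ_points_def)
  next
    fix x assume "x \<in> topspace (RZ_filtration V K k)"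
    then obtain \<sigma> where "\<sigma> \<in> K" and x: "x \<in> V \<rightarrow>\<^sub>E {-1..1}" "\<forall>i\<in>V - \<sigma>. x i \<in> {-1, 1}"
      and "card V - k \<le> card {i \<in> V. x i = -1}"
      by (auto simp: topspace_RZ_filtration RZ_points_def)
    moreover have "x \<in> cell (\<sigma>, {i \<in> V. x i = -1})"
      using x by (auto simp: cell_def PiE_iff)
    ultimately show "x \<in> (\<Union>p\<in>?F. cell p)"
      by blast
  qed
  finally show ?thesis
    by (metis RZ_filtration_eq_subtopology compact_space_subtopology)
qed


section \<open>The cones in the real moment-angle complex\<close>

text \<open>On \<open>I\<close>, the point at height \<open>s\<close> over \<open>t\<close> divides the segment from \<open>\<phi>(t)\<close> to the point
  \<open>(1, \<dots>, 1)\<close> in the ratio \<open>s : 1 - s\<close>.\<close>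

definition RZ_cone :: "'v set \<Rightarrow> 'v set \<Rightarrow> 'v set set \<Rightarrow> ('v set \<Rightarrow> real) \<times> real \<Rightarrow> 'v \<Rightarrow> real" where
  "RZ_cone V I L = (\<lambda>(t, s). \<lambda>j\<in>V. if j \<in> I then 1 - 2 * ((1 - s) * vertex_mass L t j) else -1)"

lemma RZ_cone_base:
  assumes "abstract_complex I L" and "finite I" and "t \<in> topspace (realization_Sd L)" and "I \<subseteq> V"
  shows "RZ_cone V I L (t, 0) = RZ_inclusion V I (phi I L t)"
proof
  fix j
  show "RZ_cone V I L (t, 0) j = RZ_inclusion V I (phi I L t) j"
  proof (cases "j \<in> I")
    case True
    have fin: "finite (Sd_vertices L)"
      using assms(1,2) by (rule finite_Sd_vertices)
    have "phi I L t j = (\<Sum>\<sigma>\<in>Sd_vertices L. t \<sigma> - 2 * (if j \<in> \<sigma> then t \<sigma> else 0))"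
      using True by (auto simp: phi_def affine_extension_def phi_vertex_def intro!: sum.cong)
    also have "\<dots> = 1 - 2 * vertex_mass L t j"
      using assms(3) fin
      by (simp add: sum_subtractf in_realization_Sd_iff vertex_mass_def sum.inter_filter
          flip: sum_distrib_left)
    finally show ?thesis
      using True assms(4) by (auto simp: RZ_cone_def RZ_inclusion_def)
  qed (auto simp: RZ_cone_def RZ_inclusion_def)
qed

lemma continuous_map_RZ_cone:
  assumes "abstract_complex I L" and "finite I"
  shows "continuous_map (cylinder (realization_Sd L)) (powertop_real V) (RZ_cone V I L)"
proof -
  have fin: "finite (Sd_vertices L)"
    using assms by (rule finite_Sd_vertices)
  have t: "continuous_map (cylinder (realization_Sd L)) euclideanreal (\<lambda>p. fst p \<sigma>)"
    if "\<sigma> \<in> Sd_vertices L" for \<sigma>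
  proof -
    have "continuous_map (realization_Sd L) euclideanreal (\<lambda>t. t \<sigma>)"
      unfolding realization_def using that
      by (intro continuous_map_from_subtopology continuous_map_product_projection)
    from continuous_map_compose[OF continuous_map_fst this] show ?thesis
      by (simp add: cylinder_def comp_def)
  qed
  have s: "continuous_map (cylinder (realization_Sd L)) euclideanreal snd"
    unfolding cylinder_def by (rule continuous_map_into_fulltopology[OF continuous_map_snd])
  have "continuous_map (cylinder (realization_Sd L)) euclideanreal
      (\<lambda>p. if j \<in> I then 1 - 2 * ((1 - snd p) * vertex_mass L (fst p) j) else -1)" for j
    unfolding vertex_mass_def using fin by (cases "j \<in> I") (auto intro!: continuous_intros s t)
  then show ?thesis
    by (auto simp: continuous_map_componentwise RZ_cone_def case_prod_beta)
qed

text \<open>This separates the open cones from the previous stage and from one another: off the base,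
  the coordinates equal to \<open>-1\<close> are exactly those outside \<open>I\<close>.\<close>

lemma RZ_cone_minus_one_iff:
  assumes "abstract_complex I L" and "finite I" and "t \<in> topspace (realization_Sd L)"
    and "0 \<le> s" "s \<le> 1" and "j \<in> V"
  shows "RZ_cone V I L (t, s) j = -1 \<longleftrightarrow> j \<notin> I \<or> s = 0 \<and> vertex_mass L t j = 1"
proof -
  have m: "0 \<le> vertex_mass L t j" "vertex_mass L t j \<le> 1"
    using vertex_mass_bounds[OF finite_Sd_vertices[OF assms(1,2)] assms(3)] by simp_all
  have "(1 - s) * vertex_mass L t j \<le> 1 - s"
    using m assms(5) by (simp add: mult_left_le)
  then have "(1 - s) * vertex_mass L t j = 1 \<longleftrightarrow> s = 0 \<and> vertex_mass L t j = 1"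
    using assms(4) by (cases "s = 0") auto
  then show ?thesis
    using assms(6) by (simp add: RZ_cone_def)
qed

text \<open>Coordinates outside the largest simplex of the chain carrying \<open>t\<close> have mass \<open>0\<close>, so
  they equal \<open>1\<close> on \<open>I\<close> and \<open>-1\<close> elsewhere.\<close>

lemma RZ_cone_in_RZ_points:
  assumes K: "abstract_complex V K" "finite V" "I \<subseteq> V"
    and t: "t \<in> topspace (realization_Sd (full_subcomplex K I))" and s: "0 \<le> s" "s \<le> 1"
  shows "RZ_cone V I (full_subcomplex K I) (t, s) \<in> RZ_points V K"
proof -
  let ?L = "full_subcomplex K I" and ?x = "RZ_cone V I (full_subcomplex K I) (t, s)"
  have fin: "finite (Sd_vertices ?L)"
    using abstract_complex_full_subcomplex[OF K(1,3)] finite_subset[OF K(3,2)] by (rule finite_Sd_vertices)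
  obtain \<sigma> \<tau> where "\<sigma> \<in> Sd_vertices ?L" and \<tau>: "\<tau> \<in> Sd_vertices ?L"
    and "\<forall>j\<in>\<sigma>. vertex_mass ?L t j = 1" and supp: "\<forall>j. vertex_mass ?L t j \<noteq> 0 \<longrightarrow> j \<in> \<tau>"
    using fin t by (rule realization_Sd_extremes) (rule that)
  have "0 \<le> (1 - s) * vertex_mass ?L t j" "(1 - s) * vertex_mass ?L t j \<le> 1" for j
    using vertex_mass_bounds[OF fin t, of j] s by (auto intro: mult_le_one)
  then have "?x \<in> V \<rightarrow>\<^sub>E {-1..1}"
    by (auto simp: RZ_cone_def)
  moreover have "?x j \<in> {-1, 1}" if "j \<in> V - \<tau>" for j
    using that supp by (auto simp: RZ_cone_def)
  moreover have "\<tau> \<in> K"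
    using \<tau> by (simp add: Sd_vertices_def full_subcomplex_def)
  ultimately show ?thesis
    by (auto simp: RZ_points_def)
qed

text \<open>With the maps \<open>RZ_cone\<close> in the attaching criterion, the position in the filtration is a matter of
  counting coordinates: a point of the open cone over \<open>I\<close> has exactly \<open>card V - i\<close> coordinates
  equal to \<open>-1\<close>, one too few for the previous stage, and these coordinates determine \<open>I\<close>.\<close>

theorem RZ_filtration_attach_cones:
  assumes K: "abstract_complex V K" and V: "finite V" and i: "1 \<le> i" "i \<le> card V"
  shows "obtained_by_attaching_cones (RZ_filtration V K i) (RZ_filtration V K (i - 1))
    (\<lambda>I. realization_Sd (full_subcomplex K I)) {I. I \<subseteq> V \<and> card I = i}
    (\<lambda>I. RZ_inclusion V I \<circ> phi I (full_subcomplex K I))"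
proof -
  define Y where "Y = RZ_filtration V K i"
  define X where "X = RZ_filtration V K (i - 1)"
  define L where "L = full_subcomplex K"
  define J where "J = {I. I \<subseteq> V \<and> card I = i}"
  define G where "G = (\<lambda>I. RZ_cone V I (L I))"
  have L: "abstract_complex I (L I)" "finite I" "I \<subseteq> V" "card I = i" "I \<noteq> {}" if "I \<in> J" for I
  proof -
    show "I \<subseteq> V" "card I = i"
      using that by (simp_all add: J_def)
    then show "abstract_complex I (L I)" "finite I" "I \<noteq> {}"
      using K V i(1) by (auto simp: L_def intro: abstract_complex_full_subcomplex finite_subset)
  qed
  have card_compl: "card (V - I) = card V - i" if "I \<in> J" for I
    using that V by (simp add: card_Diff_subset[OF L(2,3)] L(4))
  have KV: "\<And>\<sigma>. \<sigma> \<in> K \<Longrightarrow> \<sigma> \<subseteq> V"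
    using K by (rule abstract_complexD(2))
  have XY: "topspace X \<subseteq> topspace Y"
    by (auto simp: X_def Y_def topspace_RZ_filtration)
  have sub: "X = subtopology Y (topspace X)"
  proof -
    have "subtopology Y (topspace X) = subtopology (powertop_real V) (topspace Y \<inter> topspace X)"
      unfolding Y_def by (subst RZ_filtration_eq_subtopology) (rule subtopology_subtopology)
    also have "topspace Y \<inter> topspace X = topspace X"
      using XY by blast
    finally show ?thesis
      unfolding X_def by (metis RZ_filtration_eq_subtopology)
  qed
  have minus: "G I (t, s) j = -1 \<longleftrightarrow> j \<notin> I \<or> s = 0 \<and> vertex_mass (L I) t j = 1"
    if "I \<in> J" "t \<in> topspace (realization_Sd (L I))" "0 \<le> s" "s \<le> 1" "j \<in> V" for I t s j
    unfolding G_def using that L by (intro RZ_cone_minus_one_iff)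
  have minus_set: "{j \<in> V. G I (t, s) j = -1} = V - I"
    if "I \<in> J" "t \<in> topspace (realization_Sd (L I))" "0 < s" "s \<le> 1" for I t s
    using minus[OF that(1,2)] that(3,4) by auto
  have GY: "G I (t, s) \<in> topspace Y"
    if "I \<in> J" "t \<in> topspace (realization_Sd (L I))" "0 \<le> s" "s \<le> 1" for I t s
  proof -
    have "card (V - I) \<le> card {j \<in> V. G I (t, s) j = -1}"
      using minus[OF that] V by (intro card_mono) auto
    moreover have "G I (t, s) \<in> RZ_points V K"
      using that L K V unfolding G_def L_def by (intro RZ_cone_in_RZ_points)
    ultimately show ?thesis
      using card_compl[OF that(1)] by (simp add: Y_def topspace_RZ_filtration)
  qed
  have base: "G I (t, 0) = (RZ_inclusion V I \<circ> phi I (L I)) t"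
    if "I \<in> J" "t \<in> topspace (realization_Sd (L I))" for I t
    using RZ_cone_base[of I "L I" t V] L that by (simp add: G_def)
  have contG: "continuous_map (cylinder (realization_Sd (L I))) Y (G I)" if "I \<in> J" for I
  proof -
    have "continuous_map (cylinder (realization_Sd (L I))) (powertop_real V) (G I)"
      unfolding G_def using L(1,2)[OF that] by (rule continuous_map_RZ_cone)
    moreover have "G I \<in> topspace (cylinder (realization_Sd (L I))) \<rightarrow> topspace Y"
      using GY[OF that] by (auto simp: topspace_cylinder)
    ultimately show ?thesis
      unfolding Y_def by (subst RZ_filtration_eq_subtopology) (rule continuous_map_into_subtopology)
  qed
  have "obtained_by_attaching_cones Y X (\<lambda>I. realization_Sd (L I)) J (\<lambda>I. RZ_inclusion V I \<circ> phi I (L I))"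
  proof (rule obtained_by_attaching_conesI[where g = G])
    show "Hausdorff_space Y"
      unfolding Y_def by (rule Hausdorff_space_RZ_filtration)
    show "compact_space X"
      unfolding X_def using V KV by (rule compact_space_RZ_filtration)
    show "topspace X \<subseteq> topspace Y" "X = subtopology Y (topspace X)"
      by fact+
    show "finite J"
      using V by (simp add: J_def)
  next
    fix I assume I: "I \<in> J"
    show "compact_space (realization_Sd (L I))"
      using L[OF I] by (intro compact_space_realization_Sd)
    show "continuous_map (cylinder (realization_Sd (L I))) Y (G I)"
      using I by (rule contG)
    have "continuous_map (realization_Sd (L I)) (cylinder (realization_Sd (L I))) (\<lambda>t. (t, 0))"
      unfolding cylinder_def by (auto simp: continuous_map_pairwise comp_def)
    from continuous_map_compose[OF this contG[OF I]]
    have "continuous_map (realization_Sd (L I)) Y (RZ_inclusion V I \<circ> phi I (L I))"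
      by (rule continuous_map_eq) (simp add: base[OF I])
    \<comment> \<open>On the base a vertex of full mass is one more coordinate equal to \<open>-1\<close>.\<close>
    moreover have "G I (t, 0) \<in> topspace X" if t: "t \<in> topspace (realization_Sd (L I))" for t
    proof -
      obtain \<sigma> \<tau> where \<sigma>: "\<sigma> \<in> Sd_vertices (L I)" "\<tau> \<in> Sd_vertices (L I)"
          "\<forall>j\<in>\<sigma>. vertex_mass (L I) t j = 1" "\<forall>j. vertex_mass (L I) t j \<noteq> 0 \<longrightarrow> j \<in> \<tau>"
        using finite_Sd_vertices[OF L(1,2)[OF I]] t by (rule realization_Sd_extremes) (rule that)
      then obtain k where k: "k \<in> \<sigma>" "k \<in> I"
        using Sd_vertices_subset[OF L(1)[OF I]] by blast
      have "insert k (V - I) \<subseteq> {j \<in> V. G I (t, 0) j = -1}"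
        using minus[OF I t, of 0] \<sigma>(3) k L(3)[OF I] by auto
      then have "card (insert k (V - I)) \<le> card {j \<in> V. G I (t, 0) j = -1}"
        using V by (intro card_mono) auto
      then have "card V - (i - 1) \<le> card {j \<in> V. G I (t, 0) j = -1}"
        using k V card_compl[OF I] by simp
      then show ?thesis
        using GY[OF I t, of 0] by (simp add: X_def Y_def topspace_RZ_filtration)
    qed
    then have "RZ_inclusion V I \<circ> phi I (L I) \<in> topspace (realization_Sd (L I)) \<rightarrow> topspace X"
      using base[OF I] by (simp add: Pi_iff)
    ultimately show "continuous_map (realization_Sd (L I)) X (RZ_inclusion V I \<circ> phi I (L I))"
      by (subst sub) (rule continuous_map_into_subtopology)
  next
    fix I t assume "I \<in> J" "t \<in> topspace (realization_Sd (L I))"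
    then show "G I (t, 0) = (RZ_inclusion V I \<circ> phi I (L I)) t"
      by (rule base)
  next
    fix I t t'
    show "G I (t, 1) = G I (t', 1)"
      by (simp add: G_def RZ_cone_def cong: if_cong)
  next
    fix I t and s :: real
    assume I: "I \<in> J" "t \<in> topspace (realization_Sd (L I))" "0 < s" "s \<le> 1"
    have "card V - i < card V - (i - 1)"
      using i by arith
    then show "G I (t, s) \<notin> topspace X"
      by (simp only: X_def topspace_RZ_filtration mem_Collect_eq minus_set[OF I] card_compl[OF I(1)]
          not_le[symmetric] simp_thms)
  next
    fix I t I' t' and s s' :: real
    assume I: "I \<in> J" "t \<in> topspace (realization_Sd (L I))" "0 < s" "s \<le> 1"
      and I': "I' \<in> J" "t' \<in> topspace (realization_Sd (L I'))" "0 < s'" "s' \<le> 1"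
      and eq: "G I (t, s) = G I' (t', s')"
    have "V - I = V - I'"
      using minus_set[OF I] minus_set[OF I'] eq by simp
    then have II': "I' = I"
      using L(3)[OF I(1)] L(3)[OF I'(1)] by blast
    have "(1 - s) * vertex_mass (L I) t j = (1 - s') * vertex_mass (L I) t' j" if "j \<in> I" for j
      using fun_cong[OF eq, of j] that L(3)[OF I(1)] by (auto simp: G_def RZ_cone_def II')
    from scaled_vertex_mass_inject[OF L(1,2)[OF I(1)] I(2) _ _ _ this] I I'
    show "I = I' \<and> s = s' \<and> (t = t' \<or> s = 1)"
      by (auto simp: II')
  next
    fix x assume x: "x \<in> topspace Y" "x \<notin> topspace X"
    define I where "I = {j \<in> V. x j \<noteq> -1}"
    obtain \<sigma> where \<sigma>: "\<sigma> \<in> K" "x \<in> V \<rightarrow>\<^sub>E {-1..1}" "\<And>j. j \<in> V - \<sigma> \<Longrightarrow> x j \<in> {-1, 1}"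
      using x(1) by (auto simp: Y_def topspace_RZ_filtration RZ_points_def)
    have "card {j \<in> V. x j = -1} = card V - i"
      using x i by (auto simp: X_def Y_def topspace_RZ_filtration)
    moreover have "{j \<in> V. x j = -1} = V - I" "I \<subseteq> V"
      by (auto simp: I_def)
    ultimately have "card V - card I = card V - i" "card I \<le> card V"
      using V by (auto simp: card_Diff_subset finite_subset card_mono)
    then have I: "I \<in> J"
      using i(2) \<open>I \<subseteq> V\<close> by (simp add: J_def)
    \<comment> \<open>On \<open>I\<close> the value \<open>-1\<close> is excluded, so outside \<open>\<sigma>\<close> only the value \<open>1\<close> remains.\<close>
    have "{j \<in> I. (1 - x j) / 2 \<noteq> 0} \<subseteq> \<sigma>"
      using \<sigma>(3) by (auto simp: I_def)
    then have "{j \<in> I. (1 - x j) / 2 \<noteq> 0} \<in> L I"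
      using abstract_complexD(3)[OF K \<sigma>(1)] by (simp add: L_def full_subcomplex_def)
    moreover have "0 \<le> (1 - x j) / 2" "(1 - x j) / 2 \<le> 1" if "j \<in> I" for j
      using PiE_mem[OF \<sigma>(2), of j] that by (simp_all add: I_def)
    ultimately obtain t r where t: "t \<in> topspace (realization_Sd (L I))" and r: "0 \<le> r" "r \<le> 1"
      and tr: "\<forall>j\<in>I. r * vertex_mass (L I) t j = (1 - x j) / 2"
      using scaled_vertex_mass_surj[OF L(1,2,5)[OF I], of "\<lambda>j. (1 - x j) / 2"] by blast
    have "x j = G I (t, 1 - r) j" for j
      using tr PiE_arb[OF \<sigma>(2), of j] by (auto simp: G_def RZ_cone_def I_def)
    then show "\<exists>I\<in>J. \<exists>p\<in>topspace (cylinder (realization_Sd (L I))). x = G I p"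
      using I t r by (intro bexI[of _ I] bexI[of _ "(t, 1 - r)"]) (auto simp: topspace_cylinder)
  qed
  then show ?thesis
    by (simp add: X_def Y_def L_def J_def)
qed

theorem theorem3p1:
  fixes m i :: nat and K :: "nat set set"
  assumes "1 \<le> m"
    and "abstract_complex {1..m} K"
    and "1 \<le> i" and "i \<le> m"
  shows "obtained_by_attaching_cones
           (RZ_filtration {1..m} K i)
           (RZ_filtration {1..m} K (i - 1))
           (\<lambda>I. realization_Sd (full_subcomplex K I))
           {I. I \<subseteq> {1..m} \<and> card I = i}
           (\<lambda>I. RZ_inclusion {1..m} I \<circ> phi I (full_subcomplex K I))"
  using RZ_filtration_attach_cones[of "{1..m}" K i] assms by simp

end
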